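(* Let $T_1,\dots,T_n$ be pairwise commuting invertible transformations on a set $A$, let $\mathcal{G}:=\langle T_1,\dots,T_n\rangle$ be the Abelian group of transformations of $A$ which they generate, and let $f:A\to\mathbb{R}$ be any function. Then the following are equivalent. (1) $f$ has a $(T_1,\dots,T_n)$-periodic decomposition, i.e. there are functions $f_1,\dots,f_n:A\to\mathbb{R}$ with $f=f_1+\cdots+f_n$ and $\Delta_{T_j}f_j=0$ for $j=1,\dots,n$. (2) For every orbit $\mathcal{O}$ of $\mathcal{G}$ in $A$, every partition $B_1\cup B_2\cup\cdots\cup B_N=\{T_1|_{\mathcal{O}},T_2|_{\mathcal{O}},\dots,T_n|_{\mathcal{O}}\}$ and all elements $S_j\in[B_j]$, $j=1,\dots,N$, one has $$\Delta_{S_1}\cdots\Delta_{S_N}\bigl(f|_{\mathcal{O}}\bigr)=0.$$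
   Context: For a transformation $T:X\to X$ of a set $X$ and a function $f$ on $X$, the difference operator is $\Delta_T f:=f\circ T-f$; $f$ is called $T$-periodic (or $T$-invariant) if $\Delta_T f=0$. The orbit of $x\in A$ under $\mathcal{G}$ is $\{S(x):S\in\mathcal{G}\}$. Each $T_i$ restricts to a bijection $T_i|_{\mathcal{O}}$ of each orbit $\mathcal{O}$; the partitions are partitions into nonempty blocks of the set of these restrictions (a finite set of commuting bijections of $\mathcal{O}$; coinciding restrictions are counted once). For an Abelian group $\mathcal{H}$ and a nonempty set $B=\{b_1,\dots,b_k\}\subseteq\mathcal{H}$, $[B]:=\bigcap_{i=1}^k\langle b_i\rangle$, where $\langle b_i\rangle$ is the cyclic subgroup generated by $b_i$; in (2) the group $\mathcal{H}$ is the Abelian group of bijections of $\mathcal{O}$ generated by $T_1|_{\mathcal{O}},\dots,T_n|_{\mathcal{O}}$. *)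

theory Defs
  imports Complex_Main "HOL-Library.Disjoint_Sets" "HOL-Algebra.Generated_Groups"
    "HOL-Algebra.Group_Action"
begin

text \<open>
  Transformations of a set \<open>A\<close> are elements of \<open>Bij A\<close>, i.e. bijections of \<open>A\<close>
  that are \<open>undefined\<close> outside \<open>A\<close>. Thus two restrictions \<open>restrict (T i) Q\<close> and
  \<open>restrict (T j) Q\<close> are equal terms iff \<open>T i\<close> and \<open>T j\<close> agree on \<open>Q\<close>.
  Functions on \<open>A\<close> are total HOL functions of which only the values on \<open>A\<close> are used.
\<close>

definition diff_op :: "('a \<Rightarrow> 'a) \<Rightarrow> ('a \<Rightarrow> 'b::ab_group_add) \<Rightarrow> 'a \<Rightarrow> 'b"
  where "diff_op T f = (\<lambda>x. f (T x) - f x)"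

text \<open>\<open>diff_ops [S\<^sub>1, \<dots>, S\<^sub>N] f\<close> applies the operator of \<open>S\<^sub>N\<close> first.\<close>

definition diff_ops :: "('a \<Rightarrow> 'a) list \<Rightarrow> ('a \<Rightarrow> 'b::ab_group_add) \<Rightarrow> 'a \<Rightarrow> 'b"
  where "diff_ops Ss f = foldr diff_op Ss f"

definition periodic_on :: "'a set \<Rightarrow> ('a \<Rightarrow> 'a) \<Rightarrow> ('a \<Rightarrow> 'b::ab_group_add) \<Rightarrow> bool"
  where "periodic_on C T f \<longleftrightarrow> (\<forall>x\<in>C. diff_op T f x = 0)"

definition has_periodic_decomposition ::
    "'a set \<Rightarrow> nat \<Rightarrow> (nat \<Rightarrow> 'a \<Rightarrow> 'a) \<Rightarrow> ('a \<Rightarrow> 'b::ab_group_add) \<Rightarrow> bool"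
  where "has_periodic_decomposition A n T f \<longleftrightarrow>
    (\<exists>g :: nat \<Rightarrow> 'a \<Rightarrow> 'b.
       (\<forall>x\<in>A. f x = (\<Sum>j=1..n. g j x)) \<and>
       (\<forall>j\<in>{1..n}. periodic_on A (T j) (g j)))"

definition transformation_group :: "'a set \<Rightarrow> ('a \<Rightarrow> 'a) set \<Rightarrow> ('a \<Rightarrow> 'a) monoid"
  where "transformation_group C F = subgroup_generated (BijGroup C) F"

text \<open>The set \<open>[B]\<close>, meaningful for nonempty subsets \<open>B\<close> of \<open>carrier H\<close>.\<close>

definition cyclic_inter :: "('g, 'm) monoid_scheme \<Rightarrow> 'g set \<Rightarrow> 'g set"
  where "cyclic_inter H B = (\<Inter>b\<in>B. generate H {b})"

definition restrictions :: "'a set \<Rightarrow> nat \<Rightarrow> (nat \<Rightarrow> 'a \<Rightarrow> 'a) \<Rightarrow> ('a \<Rightarrow> 'a) set"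
  where "restrictions Q n T = (\<lambda>i. restrict (T i) Q) ` {1..n}"

end

theory Submission
  imports Defs
begin

text \<open>
  The group \<open>H\<close> generated by the restrictions to an orbit acts simply transitively on it, so
  functions on the orbit become functions on an Abelian group. There, decomposability is proved
  from the difference conditions by induction on the set \<open>B\<close> of periods. Fix \<open>a \<in> B\<close> and let \<open>J\<close>
  be the set of the other \<open>b \<in> B\<close> for which some positive power of \<open>a\<close> lies in \<open>\<langle>b\<rangle>\<close>; choose
  \<open>K > 0\<close> with \<open>a\<^sup>K \<in> \<langle>b\<rangle>\<close> for all \<open>b \<in> J\<close>. Using the block \<open>J \<union> {a}\<close>, the difference of \<open>f\<close>
  by \<open>a\<^sup>K\<close> satisfies the conditions for the remaining set \<open>C\<close> of periods, hence is a sum of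
  \<open>b\<close>-periodic functions, \<open>b \<in> C\<close>. As \<open>a\<^sup>K\<close> has infinite order modulo each such \<open>\<langle>b\<rangle>\<close>, each
  summand is the \<open>a\<^sup>K\<close>-difference of a \<open>b\<close>-periodic function; subtracting these makes \<open>f\<close>
  \<open>a\<^sup>K\<close>-periodic. Its mean over \<open>1, a, \<dots>, a\<^sup>K\<^sup>-\<^sup>1\<close> is then \<open>a\<close>-periodic, and what is left is a
  linear combination of translates of the \<open>a\<close>-difference of \<open>f\<close>, which decomposes over
  \<open>B - {a}\<close> by induction (with the block \<open>{a}\<close>).
\<close>

section \<open>Iterated differences, and antidifferences on the integers\<close>

lemma diff_ops_Nil [simp]: "diff_ops [] f = f"
  by (simp add: diff_ops_def)

lemma diff_ops_Cons [simp]: "diff_ops (S # Ss) f = diff_op S (diff_ops Ss f)"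
  by (simp add: diff_ops_def)

lemma diff_ops_snoc: "diff_ops (Ss @ [S]) f = diff_ops Ss (diff_op S f)"
  by (simp add: diff_ops_def)

lemma diff_ops_sum:
  "diff_ops Ss (\<lambda>x. \<Sum>b\<in>B. g b x) x = (\<Sum>b\<in>B. diff_ops Ss (g b) x)"
  by (induction Ss arbitrary: x) (simp_all add: diff_op_def sum_subtractf)

lemma int_antidifference:
  fixes u :: "int \<Rightarrow> 'b::ab_group_add"
  shows "\<exists>v. \<forall>m. v (m + 1) - v m = u m"
proof -
  \<comment> \<open>This is the oriented sum of \<open>u\<close> from 0 to \<open>m\<close>: for
    \<open>m\<close> nonnegative the second sum is empty, for \<open>m\<close> nonpositive the
    first.\<close>
  define v where "v m = (\<Sum>i\<in>{0..<m}. u i) - (\<Sum>i\<in>{m..<0}. u i)" for m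
  have "v (m + 1) - v m = u m" for m
  proof (cases "m \<ge> 0")
    case True
    then have "{0..<m+1} = insert m {0..<m}" by auto
    with True show ?thesis by (simp add: v_def)
  next
    case False
    then have "{m..<0} = insert m {m+1..<0}" by auto
    with False show ?thesis by (simp add: v_def)
  qed
  then show ?thesis by blast
qed

section \<open>Decompositions of functions on an Abelian group\<close>

context comm_group
begin

text \<open>The summands are indexed by the periods themselves, so coinciding restrictions share one
  summand. The passage to indices 1, ..., n is made on the orbits.\<close>

definition decomposes :: "'a set \<Rightarrow> ('a \<Rightarrow> real) \<Rightarrow> bool"
  where "decomposes B f \<longleftrightarrow>
    (\<exists>g. (\<forall>x\<in>carrier G. f x = (\<Sum>b\<in>B. g b x)) \<and>
         (\<forall>b\<in>B. \<forall>x\<in>carrier G. g b (b \<otimes> x) = g b x))"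

text \<open>Condition (2) for translations of the group. Listing the blocks pairs each with its
  element of \<open>Ss\<close>; since every ordering is allowed, a new block may be placed last,
  where its difference is applied first.\<close>

definition annihilated :: "'a set \<Rightarrow> ('a \<Rightarrow> real) \<Rightarrow> bool"
  where "annihilated B f \<longleftrightarrow>
    (\<forall>Bs Ss. distinct Bs \<and> partition_on B (set Bs) \<and>
       list_all2 (\<lambda>S C. S \<in> cyclic_inter G C) Ss Bs \<longrightarrow>
       (\<forall>x\<in>carrier G. diff_ops (map (mult G) Ss) f x = 0))"

lemma cyclic_inter_carrier:
  assumes "C \<noteq> {}" "C \<subseteq> carrier G" shows "cyclic_inter G C \<subseteq> carrier G"
proof -
  obtain b where "b \<in> C" using assms(1) by blast
  then have "generate G {b} \<subseteq> carrier G" using assms(2) by (intro generate_incl) auto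
  with \<open>b \<in> C\<close> show ?thesis unfolding cyclic_inter_def by blast
qed

lemma cyclic_inter_list_carrier:
  assumes B: "B \<subseteq> carrier G" and part: "partition_on B (set Bs)"
    and Ss: "list_all2 (\<lambda>S C. S \<in> cyclic_inter G C) Ss Bs"
  shows "set Ss \<subseteq> carrier G"
proof
  fix s assume "s \<in> set Ss"
  then obtain j where j: "j < length Bs" "s \<in> cyclic_inter G (Bs ! j)"
    using Ss by (metis in_set_conv_nth list_all2_conv_all_nth)
  have "Bs ! j \<noteq> {} \<and> Bs ! j \<subseteq> carrier G"
    using part nth_mem[OF j(1)] B by (auto simp: partition_on_def)
  then show "s \<in> carrier G"
    using j(2) cyclic_inter_carrier by blast
qed

lemma diff_ops_cong_carrier:
  assumes "set Ss \<subseteq> carrier G" "\<And>x. x \<in> carrier G \<Longrightarrow> f x = g x" "x \<in> carrier G"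
  shows "diff_ops (map (mult G) Ss) f x = diff_ops (map (mult G) Ss) g x"
  using assms(1,3) by (induction Ss arbitrary: x) (simp_all add: diff_op_def assms(2))

text \<open>Translations commute in an Abelian group, so differences of an \<open>s\<close>-periodic
  function remain \<open>s\<close>-periodic.\<close>

lemma diff_ops_invariant:
  assumes "set Ss \<subseteq> carrier G" "s \<in> carrier G"
    and "\<And>x. x \<in> carrier G \<Longrightarrow> g (s \<otimes> x) = g x" "x \<in> carrier G"
  shows "diff_ops (map (mult G) Ss) g (s \<otimes> x) = diff_ops (map (mult G) Ss) g x"
  using assms(1,4)
proof (induction Ss arbitrary: x)
  case (Cons t Ss)
  then have "t \<otimes> (s \<otimes> x) = s \<otimes> (t \<otimes> x)" using assms(2) by (simp add: m_lcomm)
  with Cons show ?case by (simp add: diff_op_def)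
qed (use assms in simp)

text \<open>The differences applied before that of \<open>s\<close> preserve
  \<open>s\<close>-periodicity, so the difference by \<open>s\<close> gives 0. All later differences
  are differences of 0.\<close>

lemma diff_ops_annihilate:
  assumes "set Ss \<subseteq> carrier G" "s \<in> set Ss"
    and "\<And>x. x \<in> carrier G \<Longrightarrow> g (s \<otimes> x) = g x" "x \<in> carrier G"
  shows "diff_ops (map (mult G) Ss) g x = 0"
  using assms(1,2,4)
proof (induction Ss arbitrary: x)
  case (Cons t Ss)
  show ?case
  proof (cases "s = t")
    case True
    then show ?thesis using Cons.prems assms(3) by (simp add: diff_op_def diff_ops_invariant)
  next
    case False
    then show ?thesis using Cons by (simp add: diff_op_def)
  qed
qed simp

lemma generate_invariant:
  assumes "b \<in> carrier G" "\<And>x. x \<in> carrier G \<Longrightarrow> g (b \<otimes> x) = g x"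
    and "s \<in> generate G {b}" "x \<in> carrier G"
  shows "g (s \<otimes> x) = g x"
  using assms(3,4)
proof (induction arbitrary: x rule: generate.induct)
  case (inv h)
  then have "g (b \<otimes> (inv b \<otimes> x)) = g (inv b \<otimes> x)" using assms by simp
  with inv show ?case using assms(1) by (simp add: m_assoc [symmetric])
next
  case (eng h1 h2)
  then have "h1 \<in> carrier G" "h2 \<in> carrier G"
    using assms(1) generate_in_carrier[of "{b}"] by auto
  with eng show ?case by (simp add: m_assoc)
qed (use assms in auto)

text \<open>Every \<open>b\<close> lies in some block, and the element chosen for that block is in
  <b>. Its difference therefore kills the \<open>b\<close>-periodic summand, whatever the other
  differences are.\<close>

lemma decomposes_imp_annihilated:
  assumes B: "B \<subseteq> carrier G" and "decomposes B f"
  shows "annihilated B f"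
  unfolding annihilated_def
proof (intro allI impI ballI, elim conjE)
  fix Bs Ss x
  assume part: "partition_on B (set Bs)"
    and Ss: "list_all2 (\<lambda>S C. S \<in> cyclic_inter G C) Ss Bs" and x: "x \<in> carrier G"
  obtain g where f: "\<And>x. x \<in> carrier G \<Longrightarrow> f x = (\<Sum>b\<in>B. g b x)"
    and g: "\<And>b x. b \<in> B \<Longrightarrow> x \<in> carrier G \<Longrightarrow> g b (b \<otimes> x) = g b x"
    using assms(2) unfolding decomposes_def by blast
  have car: "set Ss \<subseteq> carrier G"
    using cyclic_inter_list_carrier[OF B part Ss] .
  have "diff_ops (map (mult G) Ss) (g b) x = 0" if b: "b \<in> B" for b
  proof -
    obtain j where j: "j < length Bs" "b \<in> Bs ! j"
      using part b by (auto simp: partition_on_def in_set_conv_nth)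
    have "length Ss = length Bs" "Ss ! j \<in> cyclic_inter G (Bs ! j)"
      using Ss j(1) by (simp_all add: list_all2_conv_all_nth)
    then have s: "Ss ! j \<in> generate G {b}" "Ss ! j \<in> set Ss"
      using j by (auto simp: cyclic_inter_def)
    show ?thesis
    proof (rule diff_ops_annihilate[OF car s(2) _ x])
      fix y assume "y \<in> carrier G"
      show "g b (Ss ! j \<otimes> y) = g b y"
        by (rule generate_invariant[OF _ _ s(1) \<open>y \<in> carrier G\<close>, of "g b"]) (use b B g in auto)
    qed
  qed
  moreover have "diff_ops (map (mult G) Ss) f x = diff_ops (map (mult G) Ss) (\<lambda>x. \<Sum>b\<in>B. g b x) x"
    by (rule diff_ops_cong_carrier[OF car _ x]) (rule f)
  ultimately show "diff_ops (map (mult G) Ss) f x = 0"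
    by (simp add: diff_ops_sum)
qed

lemma div_eq_div:
  assumes "x \<in> carrier G" "y \<in> carrier G" "u \<in> carrier G" "v \<in> carrier G"
    and "x \<otimes> u = y \<otimes> v"
  shows "x \<otimes> inv y = v \<otimes> inv u"
proof -
  have "x = (y \<otimes> v) \<otimes> inv u"
    using assms by (subst inv_solve_right) auto
  then have "x = y \<otimes> (v \<otimes> inv u)"
    using assms(1-4) m_assoc[of y v "inv u"] by simp
  then have "v \<otimes> inv u = inv y \<otimes> x"
    using assms(1-4) by (subst inv_solve_left) auto
  then show ?thesis using assms(1,2) m_comm[of x "inv y"] by simp
qed

text \<open>Modulo <a> the powers of \<open>s\<close> stay distinct, so on each coset of <a, s> an
  \<open>a\<close>-periodic function is a function on the integers, with \<open>s\<close> acting as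
  the shift by 1. There the equation is solved by \<open>int_antidifference\<close>.\<close>

lemma invariant_antidifference:
  fixes g :: "'a \<Rightarrow> real"
  assumes a: "a \<in> carrier G" and s: "s \<in> carrier G"
    and inf: "\<And>k::nat. k > 0 \<Longrightarrow> s [^] k \<notin> generate G {a}"
    and g: "\<And>x. x \<in> carrier G \<Longrightarrow> g (a \<otimes> x) = g x"
  shows "\<exists>h. \<forall>x\<in>carrier G. h (a \<otimes> x) = h x \<and> h (s \<otimes> x) - h x = g x"
proof -
  \<comment> \<open>Only the exponent of \<open>s\<close> is determined: \<open>a\<close> may have
    finite order, so \<open>l\<close> and \<open>l'\<close> can differ.\<close>
  have uniq: "m = m'"
    if eq: "s [^] m \<otimes> a [^] l \<otimes> r = s [^] m' \<otimes> a [^] l' \<otimes> r" and r: "r \<in> carrier G"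
    for m m' l l' :: int and r
  proof -
    \<comment> \<open>By symmetry it suffices to exclude \<open>m' < m\<close>, where the difference
      is a positive natural number, as \<open>inf\<close> demands.\<close>
    have less: False if "m' < m" "s [^] m \<otimes> a [^] l = s [^] m' \<otimes> a [^] l'" for m m' l l' :: int
    proof -
      have "s [^] (m - m') = a [^] (l' - l)"
        using div_eq_div[OF _ _ _ _ that(2)] a s by (simp only: int_pow_diff int_pow_closed)
      then have "s [^] (m - m') \<in> generate G {a}"
        using generate_pow[OF a] by blast
      moreover have "s [^] nat (m - m') = s [^] (m - m')"
        using that(1) by (intro pow_nat) simp
      ultimately show False using inf[of "nat (m - m')"] that(1) by simp
    qed
    have "s [^] m \<otimes> a [^] l = s [^] m' \<otimes> a [^] l'"
      using eq r a s by simp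
    with less[of m' m l l'] less[of m m' l' l] show ?thesis
      by (metis linorder_cases)
  qed
  \<comment> \<open>Write \<open>x = s\<^sup>m a\<^sup>l r\<close> with \<open>r\<close> the chosen representative of the coset of \<open>x\<close> modulo
    \<open>\<langle>a, s\<rangle>\<close>; the exponent \<open>m\<close> is then unique, and \<open>h x\<close> is obtained by summing \<open>g\<close> along
    the powers of \<open>s\<close>.\<close>
  define cls where "cls x = {r \<in> carrier G. \<exists>(m::int) (l::int). x = s [^] m \<otimes> a [^] l \<otimes> r}" for x
  define rep where "rep x = (SOME r. r \<in> cls x)" for x
  define ht where "ht x = (THE m::int. \<exists>l::int. x = s [^] m \<otimes> a [^] l \<otimes> rep x)" for x
  have rep: "rep x \<in> cls x" if "x \<in> carrier G" for x
  proof -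
    have "\<exists>(m::int) (l::int). x = s [^] m \<otimes> a [^] l \<otimes> x"
      using that by (intro exI[of _ 0]) simp
    then have "x \<in> cls x" using that unfolding cls_def by blast
    then show ?thesis unfolding rep_def by (rule someI)
  qed
  have ht: "ht x = m" if "x \<in> carrier G" "x = s [^] m \<otimes> a [^] l \<otimes> rep x" for x m and l :: int
    unfolding ht_def
  proof (rule the_equality)
    show "\<exists>l::int. x = s [^] m \<otimes> a [^] l \<otimes> rep x" using that(2) by blast
    fix m' :: int assume "\<exists>l::int. x = s [^] m' \<otimes> a [^] l \<otimes> rep x"
    then obtain l' :: int where "x = s [^] m' \<otimes> a [^] l' \<otimes> rep x" by blast
    with that(2) have "s [^] m' \<otimes> a [^] l' \<otimes> rep x = s [^] m \<otimes> a [^] l \<otimes> rep x" by simp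
    then show "m' = m" by (rule uniq) (use rep[OF that(1)] in \<open>simp add: cls_def\<close>)
  qed
  have step: "s [^] (i + m) \<otimes> a [^] (j + l) \<otimes> r = s [^] i \<otimes> a [^] j \<otimes> (s [^] m \<otimes> a [^] l \<otimes> r)"
    if "r \<in> carrier G" for i j m l :: int and r
  proof -
    have "s [^] i \<otimes> s [^] m \<otimes> (a [^] j \<otimes> a [^] l) = s [^] i \<otimes> a [^] j \<otimes> (s [^] m \<otimes> a [^] l)"
      using a s by (simp add: m_ac)
    then show ?thesis using that a s by (simp add: int_pow_mult m_assoc)
  qed
  have cls_shift: "cls (s [^] i \<otimes> a [^] j \<otimes> x) = cls x" if x: "x \<in> carrier G" for i j :: int and x
  proof -
    \<comment> \<open>One inclusion is enough: applied to the shifted point and the opposite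
      exponents it gives the other. Equality of the sets makes \<open>SOME\<close> pick the same
      representative.\<close>
    have sub: "cls x \<subseteq> cls (s [^] i \<otimes> a [^] j \<otimes> x)" if "x \<in> carrier G" for i j :: int and x
    proof
      fix r assume "r \<in> cls x"
      then obtain m l :: int where r: "r \<in> carrier G" "x = s [^] m \<otimes> a [^] l \<otimes> r"
        unfolding cls_def by blast
      then have "s [^] i \<otimes> a [^] j \<otimes> x = s [^] (i + m) \<otimes> a [^] (j + l) \<otimes> r"
        using step by simp
      then show "r \<in> cls (s [^] i \<otimes> a [^] j \<otimes> x)" using r(1) unfolding cls_def by blast
    qed
    have "s [^] (-i) \<otimes> a [^] (-j) \<otimes> (s [^] i \<otimes> a [^] j \<otimes> x) = x"
      using step[OF x, of "-i" i "-j" j] x by simp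
    then show ?thesis
      using sub[OF x, of i j] sub[of "s [^] i \<otimes> a [^] j \<otimes> x" "-i" "-j"] a s x by auto
  qed
  have shift: "rep (s [^] i \<otimes> a [^] j \<otimes> x) = rep x \<and> ht (s [^] i \<otimes> a [^] j \<otimes> x) = i + ht x"
    if x: "x \<in> carrier G" for i j :: int and x
  proof
    show eq: "rep (s [^] i \<otimes> a [^] j \<otimes> x) = rep x"
      unfolding rep_def using cls_shift[OF x] by simp
    obtain m l :: int where r: "rep x \<in> carrier G" and ml: "x = s [^] m \<otimes> a [^] l \<otimes> rep x"
      using rep[OF x] unfolding cls_def by blast
    have "s [^] i \<otimes> a [^] j \<otimes> x = s [^] (i + m) \<otimes> a [^] (j + l) \<otimes> rep x"
      using step[OF r, of i m j l] ml by simp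
    then have "ht (s [^] i \<otimes> a [^] j \<otimes> x) = i + m"
      by (intro ht[where l = "j + l"]) (use a s r x eq in auto)
    with ht[OF x ml] show "ht (s [^] i \<otimes> a [^] j \<otimes> x) = i + ht x" by simp
  qed
  have "\<forall>r. \<exists>v. \<forall>m::int. v (m + 1) - v m = g (s [^] m \<otimes> r)"
    by (intro allI int_antidifference)
  then obtain v where v: "\<And>r m. v r (m + 1) - v r m = g (s [^] (m::int) \<otimes> r)"
    by metis
  define h where "h x = v (rep x) (ht x)" for x
  have "h (a \<otimes> x) = h x \<and> h (s \<otimes> x) - h x = g x" if x: "x \<in> carrier G" for x
  proof
    show "h (a \<otimes> x) = h x"
      using shift[OF x, of 0 1] a s by (simp add: h_def)
    obtain m l :: int where r: "rep x \<in> carrier G" and ml: "x = s [^] m \<otimes> a [^] l \<otimes> rep x"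
      using rep[OF x] unfolding cls_def by blast
    have al: "a [^] l \<in> generate G {a}" using generate_pow[OF a] by blast
    \<comment> \<open>The factor \<open>a [^] l\<close> is absorbed by the periodicity of
      \<open>g\<close>; hence \<open>h\<close> may depend on the representative and the exponent of
      \<open>s\<close> alone.\<close>
    have "g x = g (a [^] l \<otimes> (s [^] m \<otimes> rep x))"
      using ml a s r m_lcomm[of "s [^] m" "a [^] l" "rep x"] by (simp add: m_assoc)
    also have "\<dots> = g (s [^] m \<otimes> rep x)"
      using generate_invariant[of a g, OF a g al] s r by simp
    finally show "h (s \<otimes> x) - h x = g x"
      using shift[OF x, of 1 0] a s ht[OF x ml] v[of "rep x" m] by (simp add: h_def add.commute)
  qed
  then show ?thesis by blast
qed

text \<open>A partition of \<open>B - C\<close> becomes one of \<open>B\<close> by appending the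
  block \<open>C\<close>, with \<open>s\<close> as its element. This is how the induction trades a
  block of periods for one difference.\<close>

lemma annihilated_diff_op:
  assumes "annihilated B f" "C \<subseteq> B" "C \<noteq> {}" "s \<in> cyclic_inter G C"
  shows "annihilated (B - C) (diff_op (mult G s) f)"
  unfolding annihilated_def
proof (intro allI impI ballI, elim conjE)
  fix Bs Ss x
  assume Bs: "distinct Bs" "partition_on (B - C) (set Bs)"
    and Ss: "list_all2 (\<lambda>S C. S \<in> cyclic_inter G C) Ss Bs" and x: "x \<in> carrier G"
  have disj: "disjnt C (\<Union>(set Bs))"
    using Bs(2) by (auto simp: partition_on_def disjnt_def)
  have "partition_on B (set (Bs @ [C]))"
    using partition_on_insert[OF disj, of B] Bs(2) assms(2,3) by simp
  moreover have "distinct (Bs @ [C])"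
    using Bs(1) disj assms(3) by (auto simp: disjnt_def)
  moreover have "list_all2 (\<lambda>S C. S \<in> cyclic_inter G C) (Ss @ [s]) (Bs @ [C])"
    using Ss assms(4) by (simp add: list_all2_appendI)
  ultimately have "diff_ops (map (mult G) (Ss @ [s])) f x = 0"
    using assms(1) x unfolding annihilated_def by blast
  then show "diff_ops (map (mult G) Ss) (diff_op (mult G s) f) x = 0"
    by (simp add: diff_ops_snoc)
qed

lemma decomposes_insert_of_diff:
  fixes f :: "'a \<Rightarrow> real"
  assumes a: "a \<in> carrier G" and B: "finite B" "B \<subseteq> carrier G" "a \<notin> B" and K: "K > (0::nat)"
    and per: "\<And>x. x \<in> carrier G \<Longrightarrow> f (a [^] K \<otimes> x) = f x"
    and dec: "decomposes B (diff_op (mult G a) f)"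
  shows "decomposes (insert a B) f"
proof -
  obtain F where F: "\<And>x. x \<in> carrier G \<Longrightarrow> diff_op (mult G a) f x = (\<Sum>b\<in>B. F b x)"
    and Fper: "\<And>b x. b \<in> B \<Longrightarrow> x \<in> carrier G \<Longrightarrow> F b (b \<otimes> x) = F b x"
    using dec unfolding decomposes_def by blast
  define M where "M x = (\<Sum>i<K. f (a [^] i \<otimes> x)) / K" for x
  \<comment> \<open>Chosen so that \<open>P\<close> turns the \<open>a\<close>-difference of
    \<open>f\<close> into \<open>f - M\<close>: the inner sum telescopes to
    \<open>f (a [^] i \<otimes> x) - f x\<close>, and the mean over \<open>i < K\<close> is taken.
    Being linear and built from translates, \<open>P\<close> keeps
    \<open>b\<close>-periodicity.\<close>
  define P where "P u x = - (\<Sum>i<K. \<Sum>l<i. u (a [^] l \<otimes> x)) / K" for u :: "'a \<Rightarrow> real" and x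
  have pow: "a [^] Suc i \<otimes> x = a \<otimes> (a [^] i \<otimes> x)"
    "a [^] i \<otimes> (a \<otimes> x) = a [^] Suc i \<otimes> x" if "x \<in> carrier G" for i :: nat and x
    using a that by (simp_all add: m_ac)
  have M: "M (a \<otimes> x) = M x" if x: "x \<in> carrier G" for x
  proof -
    have "(\<Sum>i<K. f (a [^] i \<otimes> (a \<otimes> x))) - (\<Sum>i<K. f (a [^] i \<otimes> x))
        = (\<Sum>i<K. f (a [^] Suc i \<otimes> x) - f (a [^] i \<otimes> x))"
      unfolding sum_subtractf pow(2)[OF x] ..
    also have "\<dots> = f (a [^] K \<otimes> x) - f (a [^] (0::nat) \<otimes> x)"
      by (rule sum_lessThan_telescope)
    also have "\<dots> = 0" using per x by simp
    finally show ?thesis by (simp add: M_def)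
  qed
  have f_eq: "f x = M x + (\<Sum>b\<in>B. P (F b) x)" if x: "x \<in> carrier G" for x
  proof -
    have tel: "(\<Sum>l<i. \<Sum>b\<in>B. F b (a [^] l \<otimes> x)) = f (a [^] i \<otimes> x) - f x" for i :: nat
    proof -
      have "(\<Sum>l<i. \<Sum>b\<in>B. F b (a [^] l \<otimes> x)) = (\<Sum>l<i. f (a [^] Suc l \<otimes> x) - f (a [^] l \<otimes> x))"
      proof (rule sum.cong[OF refl])
        fix l :: nat
        have "(\<Sum>b\<in>B. F b (a [^] l \<otimes> x)) = diff_op (mult G a) f (a [^] l \<otimes> x)"
          by (rule F [symmetric]) (simp add: a x)
        also have "\<dots> = f (a [^] Suc l \<otimes> x) - f (a [^] l \<otimes> x)"
          unfolding diff_op_def pow(1)[OF x] ..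
        finally show "(\<Sum>b\<in>B. F b (a [^] l \<otimes> x)) = f (a [^] Suc l \<otimes> x) - f (a [^] l \<otimes> x)" .
      qed
      also have "\<dots> = f (a [^] i \<otimes> x) - f (a [^] (0::nat) \<otimes> x)"
        by (rule sum_lessThan_telescope)
      finally show ?thesis using x by simp
    qed
    have "(\<Sum>b\<in>B. P (F b) x) = - (\<Sum>i<K. \<Sum>l<i. \<Sum>b\<in>B. F b (a [^] l \<otimes> x)) / K"
      unfolding P_def sum_negf sum_divide_distrib[symmetric]
      by (subst sum.swap, subst sum.swap, rule refl)
    also have "\<dots> = - (\<Sum>i<K. f (a [^] i \<otimes> x) - f x) / K"
      unfolding tel ..
    also have "\<dots> = f x - M x"
      using K by (simp add: M_def sum_subtractf field_simps)
    finally show ?thesis by simp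
  qed
  have P: "P (F b) (b \<otimes> x) = P (F b) x" if "b \<in> B" "x \<in> carrier G" for b x
  proof -
    have "F b (a [^] l \<otimes> (b \<otimes> x)) = F b (a [^] l \<otimes> x)" for l :: nat
      using Fper[of b "a [^] l \<otimes> x"] that a B(2) by (simp add: m_lcomm subset_iff)
    then show ?thesis by (simp add: P_def)
  qed
  \<comment> \<open>As \<open>a\<close> is not in \<open>B\<close>, assigning \<open>M\<close> to
    \<open>a\<close> overwrites no summand.\<close>
  define g where "g b = (if b = a then M else P (F b))" for b
  have "f x = (\<Sum>b\<in>insert a B. g b x)" if "x \<in> carrier G" for x
  proof -
    have "(\<Sum>b\<in>B. g b x) = (\<Sum>b\<in>B. P (F b) x)"
      using B(3) by (intro sum.cong) (auto simp: g_def)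
    then show ?thesis using B f_eq[OF that] by (simp add: g_def)
  qed
  moreover have "\<forall>b\<in>insert a B. \<forall>x\<in>carrier G. g b (b \<otimes> x) = g b x"
    using M P B(3) by (auto simp: g_def)
  ultimately show ?thesis unfolding decomposes_def by blast
qed

text \<open>Merges periodic functions into the summands having the same period. It serves to pass
  between \<open>f\<close> and its correction by antidifferences.\<close>

lemma decomposes_add_sum:
  fixes f :: "'a \<Rightarrow> real"
  assumes "finite B" "C \<subseteq> B" and h: "\<And>b x. b \<in> C \<Longrightarrow> x \<in> carrier G \<Longrightarrow> h b (b \<otimes> x) = h b x"
    and f: "\<And>x. x \<in> carrier G \<Longrightarrow> f x = f' x + (\<Sum>b\<in>C. h b x)" and "decomposes B f'"
  shows "decomposes B f"
proof -
  obtain g where g: "\<And>x. x \<in> carrier G \<Longrightarrow> f' x = (\<Sum>b\<in>B. g b x)"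
     "\<And>b x. b \<in> B \<Longrightarrow> x \<in> carrier G \<Longrightarrow> g b (b \<otimes> x) = g b x"
    using assms(5) unfolding decomposes_def by blast
  define g' where "g' b x = g b x + (if b \<in> C then h b x else 0)" for b x
  have "(\<Sum>b\<in>B. if b \<in> C then h b x else 0) = (\<Sum>b\<in>C. h b x)" for x
    using assms(1,2) by (simp add: sum.If_cases Int_absorb1)
  then have "\<forall>x\<in>carrier G. f x = (\<Sum>b\<in>B. g' b x)"
    by (simp add: f g(1) g'_def sum.distrib)
  moreover have "\<forall>b\<in>B. \<forall>x\<in>carrier G. g' b (b \<otimes> x) = g' b x"
    using g(2) h by (simp add: g'_def)
  ultimately show ?thesis unfolding decomposes_def by blast
qed

lemma annihilated_imp_decomposes:
  assumes "finite B" "B \<subseteq> carrier G" "annihilated B f"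
  shows "decomposes B f"
  using assms
proof (induction B arbitrary: f rule: finite_psubset_induct)
  case (psubset B)
  show ?case
  proof (cases "B = {}")
    case True
    \<comment> \<open>The empty set has the empty partition, whose product of differences is the
      identity; so \<open>f\<close> vanishes, as does the empty sum.\<close>
    have "\<forall>x\<in>carrier G. diff_ops (map (mult G) []) f x = 0"
      using psubset.prems(2) True unfolding annihilated_def
      by (metis distinct.simps(1) list.rel_inject(1) list.set(1) partition_on_empty)
    then show ?thesis using True by (simp add: decomposes_def)
  next
    case False
    then obtain a where aB: "a \<in> B" by blast
    then have a: "a \<in> carrier G" using psubset.prems by blast
    define J where "J = {b \<in> B - {a}. \<exists>k::nat. k > 0 \<and> a [^] k \<in> generate G {b}}"
    \<comment> \<open>These are the \<open>b\<close> for which no positive power of \<open>a\<close>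
      lies in <b>. Since \<open>a\<close> is removed, \<open>C\<close> is a proper subset of
      \<open>B\<close> and the induction hypothesis applies.\<close>
    define C where "C = B - insert a J"
    have fin: "finite J" "finite C" and sub: "J \<subseteq> B" "C \<subset> B" "a \<notin> J"
      using psubset.hyps aB by (auto simp: J_def C_def)
    have "\<forall>b\<in>J. \<exists>k::nat. k > 0 \<and> a [^] k \<in> generate G {b}"
      by (simp add: J_def)
    then obtain k :: "'a \<Rightarrow> nat" where k: "\<And>b. b \<in> J \<Longrightarrow> k b > 0 \<and> a [^] k b \<in> generate G {b}"
      by metis
    \<comment> \<open>A common multiple of all \<open>k b\<close>, so \<open>a [^] K\<close> is a
      power of each \<open>a [^] k b\<close>. If \<open>J\<close> is empty, \<open>K\<close> is
      1.\<close>
    define K where "K = prod k J"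
    have K: "K > 0" unfolding K_def using k by (simp add: prod_pos)
    have aK: "a [^] K \<in> carrier G" using a by simp
    have "a [^] K \<in> generate G {b}" if b: "b \<in> insert a J" for b
    proof (cases "b = a")
      case True
      then show ?thesis using generate_pow[OF a] int_pow_int[of G a K] by (metis (mono_tags, lifting) UNIV_I mem_Collect_eq)
    next
      case False
      with b have bJ: "b \<in> J" by simp
      then have bc: "b \<in> carrier G" using sub psubset.prems by blast
      obtain i :: int where "a [^] k b = b [^] i" using k[OF bJ] generate_pow[OF bc] by auto
      moreover obtain q where "K = k b * q"
        using dvd_prodI[OF fin(1) bJ, of k] by (auto simp: K_def)
      ultimately have "a [^] K = (b [^] i) [^] int q"
        using a by (metis nat_pow_pow int_pow_int)
      then have "a [^] K = b [^] (i * int q)"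
        using bc by (simp only: int_pow_pow)
      then show ?thesis using generate_pow[OF bc] by auto
    qed
    then have aKC: "a [^] K \<in> cyclic_inter G (insert a J)"
      by (auto simp: cyclic_inter_def)
    have "annihilated C (diff_op (mult G (a [^] K)) f)"
      unfolding C_def using psubset.prems(2) sub aB aKC by (intro annihilated_diff_op) auto
    then have "decomposes C (diff_op (mult G (a [^] K)) f)"
      using psubset.IH[OF sub(2)] psubset.prems(1) sub(2) by blast
    then obtain g where g: "\<And>x. x \<in> carrier G \<Longrightarrow> diff_op (mult G (a [^] K)) f x = (\<Sum>b\<in>C. g b x)"
        "\<And>b x. b \<in> C \<Longrightarrow> x \<in> carrier G \<Longrightarrow> g b (b \<otimes> x) = g b x"
      unfolding decomposes_def by blast
    have "\<exists>h. \<forall>x\<in>carrier G. h (b \<otimes> x) = h x \<and> h (a [^] K \<otimes> x) - h x = g b x" if b: "b \<in> C" for b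
    proof (rule invariant_antidifference[OF _ aK])
      show "b \<in> carrier G" using b sub psubset.prems by blast
      fix i :: nat assume "i > 0"
      then have "K * i > 0" using K by simp
      \<comment> \<open>Otherwise the positive exponent \<open>K * i\<close> would put
        \<open>b\<close> into \<open>J\<close>.\<close>
      then have "a [^] (K * i) \<notin> generate G {b}" using b unfolding C_def J_def by blast
      then show "(a [^] K) [^] i \<notin> generate G {b}" using a by (simp add: nat_pow_pow)
    qed (use b g(2) in auto)
    then obtain h where h: "\<And>b x. b \<in> C \<Longrightarrow> x \<in> carrier G \<Longrightarrow> h b (b \<otimes> x) = h b x"
      "\<And>b x. b \<in> C \<Longrightarrow> x \<in> carrier G \<Longrightarrow> h b (a [^] K \<otimes> x) - h b x = g b x"
      by metis
    define f' where "f' x = f x - (\<Sum>b\<in>C. h b x)" for x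
    have per: "f' (a [^] K \<otimes> x) = f' x" if x: "x \<in> carrier G" for x
    proof -
      have "f' (a [^] K \<otimes> x) - f' x
          = diff_op (mult G (a [^] K)) f x - (\<Sum>b\<in>C. h b (a [^] K \<otimes> x) - h b x)"
        by (simp add: f'_def diff_op_def sum_subtractf)
      also have "\<dots> = 0" using g(1)[OF x] h(2) x by simp
      finally show ?thesis by simp
    qed
    have decf: "decomposes (B - {a}) (diff_op (mult G a) f)"
    proof (rule psubset.IH)
      show "annihilated (B - {a}) (diff_op (mult G a) f)"
        using psubset.prems(2) aB generate.incl[of a "{a}" G]
        by (intro annihilated_diff_op) (auto simp: cyclic_inter_def)
    qed (use aB psubset.prems in auto)
    \<comment> \<open>Replacing \<open>f\<close> by \<open>f'\<close> changes the
      \<open>a\<close>-difference only by the \<open>a\<close>-differences of the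
      \<open>h b\<close>. These are \<open>b\<close>-periodic with \<open>b\<close> in
      \<open>B - {a}\<close>.\<close>
    have decf': "decomposes (B - {a}) (diff_op (mult G a) f')"
    proof (rule decomposes_add_sum[OF _ _ _ _ decf])
      show "C \<subseteq> B - {a}" by (auto simp: C_def)
      show "diff_op (mult G a) f' x
          = diff_op (mult G a) f x + (\<Sum>b\<in>C. - diff_op (mult G a) (h b) x)" for x
        by (simp add: f'_def diff_op_def sum_subtractf sum_negf)
      show "- diff_op (mult G a) (h b) (b \<otimes> x) = - diff_op (mult G a) (h b) x"
        if "b \<in> C" "x \<in> carrier G" for b x
      proof -
        have "b \<in> carrier G" using that sub psubset.prems by blast
        then show ?thesis using that h(1)[of b x] h(1)[of b "a \<otimes> x"] a
          by (simp add: diff_op_def m_lcomm)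
      qed
    qed (use psubset.hyps in simp)
    have "decomposes (insert a (B - {a})) f'"
      by (rule decomposes_insert_of_diff[OF a _ _ _ K per decf'])
         (use psubset.hyps psubset.prems in auto)
    then have "decomposes B f'" using aB by (simp add: insert_absorb)
    then show ?thesis
      by (rule decomposes_add_sum[where C = C and h = h, rotated 4])
         (use psubset.hyps sub h(1) in \<open>auto simp: f'_def\<close>)
  qed
qed

theorem decomposes_iff_annihilated:
  assumes "finite B" "B \<subseteq> carrier G"
  shows "decomposes B f \<longleftrightarrow> annihilated B f"
  using assms annihilated_imp_decomposes decomposes_imp_annihilated by blast

end

section \<open>Commutativity of a group with commuting generators\<close>

lemma (in group) commute_generate:
  assumes "x \<in> carrier G" "F \<subseteq> carrier G" "\<And>b. b \<in> F \<Longrightarrow> x \<otimes> b = b \<otimes> x"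
    and "s \<in> generate G F"
  shows "x \<otimes> s = s \<otimes> x"
  using assms(4)
proof (induction rule: generate.induct)
  case (inv h)
  then have h: "h \<in> carrier G" "x \<otimes> h = h \<otimes> x" using assms by auto
  then have "x = inv h \<otimes> (x \<otimes> h)"
    using assms(1) by (subst inv_solve_left) auto
  then have "x = (inv h \<otimes> x) \<otimes> h"
    using assms(1) h(1) by (simp add: m_assoc)
  then have "inv h \<otimes> x = x \<otimes> inv h"
    using assms(1) h(1) by (subst inv_solve_right) auto
  then show ?case ..
next
  case (eng h1 h2)
  then have "h1 \<in> carrier G" "h2 \<in> carrier G"
    using assms(2) generate_in_carrier by auto
  with eng assms(1) show ?case by (metis m_assoc)
qed (use assms in auto)

text \<open>\<open>commute_generate\<close> is used twice: generators commute with every element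
  \<open>y\<close>, and hence \<open>y\<close> with every element \<open>x\<close>.\<close>

lemma (in group) comm_group_subgroup_generated:
  assumes F: "F \<subseteq> carrier G" and comm: "\<And>a b. a \<in> F \<Longrightarrow> b \<in> F \<Longrightarrow> a \<otimes> b = b \<otimes> a"
  shows "comm_group (subgroup_generated G F)"
proof (rule group.group_comm_groupI[OF group_subgroup_generated])
  fix x y
  assume "x \<in> carrier (subgroup_generated G F)" "y \<in> carrier (subgroup_generated G F)"
  then have x: "x \<in> generate G F" and y: "y \<in> generate G F"
    using F by (simp_all add: carrier_subgroup_generated Int_absorb1)
  have "b \<otimes> y = y \<otimes> b" if "b \<in> F" for b
    using commute_generate[OF _ F comm y, of b] that F by blast
  then have "y \<otimes> x = x \<otimes> y"
    using commute_generate[OF generate_in_carrier[OF F y] F _ x] by metis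
  then show "x \<otimes>\<^bsub>subgroup_generated G F\<^esub> y = y \<otimes>\<^bsub>subgroup_generated G F\<^esub> x"
    by simp
qed

section \<open>Transformation groups and their orbits\<close>

lemma carrier_transformation_group: "carrier (transformation_group C F) \<subseteq> Bij C"
  using group.carrier_subgroup_generated_subset[OF group_BijGroup, of C F]
  by (simp add: transformation_group_def BijGroup_def)

lemma group_transformation_group: "group (transformation_group C F)"
  unfolding transformation_group_def by (rule group.group_subgroup_generated[OF group_BijGroup])

lemma mult_transformation_group_apply:
  assumes "f \<in> carrier (transformation_group C F)" "g \<in> carrier (transformation_group C F)" "x \<in> C"
  shows "(f \<otimes>\<^bsub>transformation_group C F\<^esub> g) x = f (g x)"
proof -
  have "f \<in> Bij C" "g \<in> Bij C" using assms carrier_transformation_group by blast+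
  then show ?thesis using assms(3) by (simp add: transformation_group_def BijGroup_def compose_def)
qed

lemma one_transformation_group_apply:
  "x \<in> C \<Longrightarrow> \<one>\<^bsub>transformation_group C F\<^esub> x = x"
  by (simp add: transformation_group_def BijGroup_def)

lemma transformation_group_apply_mem:
  "f \<in> carrier (transformation_group C F) \<Longrightarrow> x \<in> C \<Longrightarrow> f x \<in> C"
  using carrier_transformation_group[of C F] Bij_imp_funcset by blast

lemma transformation_group_incl:
  "F \<subseteq> Bij C \<Longrightarrow> F \<subseteq> carrier (transformation_group C F)"
  unfolding transformation_group_def
  using group.subgroup_generated_subset_carrier_subset[OF group_BijGroup, of F C]
  by (simp add: BijGroup_def)

lemma transformation_group_inv_apply:
  assumes "f \<in> carrier (transformation_group C F)" "x \<in> C"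
  shows "f ((inv\<^bsub>transformation_group C F\<^esub> f) x) = x"
proof -
  interpret group "transformation_group C F" by (rule group_transformation_group)
  have "f ((inv\<^bsub>transformation_group C F\<^esub> f) x)
      = (f \<otimes>\<^bsub>transformation_group C F\<^esub> inv\<^bsub>transformation_group C F\<^esub> f) x"
    by (rule mult_transformation_group_apply[OF assms(1) inv_closed[OF assms(1)] assms(2), symmetric])
  also have "\<dots> = x" unfolding r_inv[OF assms(1)] using assms(2) by (rule one_transformation_group_apply)
  finally show ?thesis .
qed

lemma orbit_eq:
  assumes "Q \<in> orbits (transformation_group C F) C (\<lambda>S. S)" "x \<in> Q"
  shows "x \<in> C \<and> Q = orbit (transformation_group C F) (\<lambda>S. S) x"
proof -
  let ?G = "transformation_group C F"
  interpret group ?G by (rule group_transformation_group)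
  obtain y where y: "y \<in> C" "Q = orbit ?G (\<lambda>S. S) y" using assms(1) by (auto simp: orbits_def)
  then obtain S where S: "S \<in> carrier ?G" "x = S y" using assms(2) by (auto simp: orbit_def)
  have x: "x \<in> C" using S y transformation_group_apply_mem by simp
  have "R x \<in> Q" if "R \<in> carrier ?G" for R
  proof -
    have "R x = (R \<otimes>\<^bsub>?G\<^esub> S) y" using that S y by (simp add: mult_transformation_group_apply)
    then show ?thesis using that S y by (auto simp: orbit_def)
  qed
  \<comment> \<open>The witness is \<open>R\<close> times the inverse of \<open>S\<close>, as that
    inverse carries \<open>x\<close> back to \<open>y\<close>.\<close>
  moreover have "\<exists>R'\<in>carrier ?G. R y = R' x" if R: "R \<in> carrier ?G" for R
  proof
    have "inv\<^bsub>?G\<^esub> S \<otimes>\<^bsub>?G\<^esub> S = \<one>\<^bsub>?G\<^esub>" using S by simp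
    then have "(inv\<^bsub>?G\<^esub> S) x = y"
      using S y mult_transformation_group_apply[of "inv\<^bsub>?G\<^esub> S" C F S y]
      by (simp add: one_transformation_group_apply)
    then show "R y = (R \<otimes>\<^bsub>?G\<^esub> inv\<^bsub>?G\<^esub> S) x"
      using R S x by (simp add: mult_transformation_group_apply)
  qed (use R S in simp)
  ultimately show ?thesis using x y by (auto simp: orbit_def)
qed

text \<open>Surjectivity onto \<open>Q\<close> holds because the inverse of \<open>f\<close> is also
  in the group and so maps \<open>Q\<close> into itself.\<close>

lemma orbit_restrict_Bij:
  assumes Q: "Q \<in> orbits (transformation_group C F) C (\<lambda>S. S)"
    and f: "f \<in> carrier (transformation_group C F)"
  shows "restrict f Q \<in> Bij Q"
proof -
  let ?G = "transformation_group C F"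
  interpret group ?G by (rule group_transformation_group)
  have closed: "R x \<in> Q" if "R \<in> carrier ?G" "x \<in> Q" for R x
    using orbit_eq[OF Q that(2)] that(1) by (auto simp: orbit_def)
  have "inj_on f C" using f carrier_transformation_group by (fastforce simp: Bij_def bij_betw_def)
  then have "inj_on f Q" using orbit_eq[OF Q] by (meson inj_on_subset subsetI)
  moreover have "f ` Q = Q"
  proof
    show "f ` Q \<subseteq> Q" using closed f by blast
    show "Q \<subseteq> f ` Q"
    proof
      fix x assume "x \<in> Q"
      then have "f ((inv\<^bsub>?G\<^esub> f) x) = x" "(inv\<^bsub>?G\<^esub> f) x \<in> Q"
        using orbit_eq[OF Q] f closed by (auto intro!: transformation_group_inv_apply)
      then show "x \<in> f ` Q" by (metis imageI)
    qed
  qed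
  ultimately show ?thesis by (simp add: Bij_def bij_betw_def inj_on_def)
qed

section \<open>Identifying an orbit with its group of restrictions\<close>

locale commuting_transformations =
  fixes A :: "'a set" and n :: nat and T :: "nat \<Rightarrow> 'a \<Rightarrow> 'a"
  assumes T_bij: "i \<in> {1..n} \<Longrightarrow> T i \<in> Bij A"
    and T_comm: "\<lbrakk>i \<in> {1..n}; j \<in> {1..n}; x \<in> A\<rbrakk> \<Longrightarrow> T i (T j x) = T j (T i x)"
begin

abbreviation "G \<equiv> transformation_group A (T ` {1..n})"

abbreviation "H Q \<equiv> transformation_group Q (restrictions Q n T)"

lemma T_carrier: "i \<in> {1..n} \<Longrightarrow> T i \<in> carrier G"
  using transformation_group_incl[of "T ` {1..n}" A] T_bij by blast

context
  fixes Q assumes Q: "Q \<in> orbits G A (\<lambda>S. S)"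
begin

lemma Q_subset: "Q \<subseteq> A"
  using orbit_eq[OF Q] by blast

lemma Q_nonempty: "Q \<noteq> {}"
proof -
  interpret group G by (rule group_transformation_group)
  show ?thesis using Q one_closed by (auto simp: orbits_def orbit_def)
qed

lemma T_closed:
  assumes "i \<in> {1..n}" "x \<in> Q" shows "T i x \<in> Q"
  using orbit_eq[OF Q assms(2)] T_carrier[OF assms(1)] unfolding orbit_def by blast

lemma restrictions_carrier: "restrictions Q n T \<subseteq> carrier (H Q)"
  using orbit_restrict_Bij[OF Q T_carrier]
  by (intro transformation_group_incl) (auto simp: restrictions_def)

lemma comm_group_H: "comm_group (H Q)"
  unfolding transformation_group_def
proof (rule group.comm_group_subgroup_generated[OF group_BijGroup])
  show sub: "restrictions Q n T \<subseteq> carrier (BijGroup Q)"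
    using restrictions_carrier carrier_transformation_group by (fastforce simp: BijGroup_def)
  fix a b assume ab: "a \<in> restrictions Q n T" "b \<in> restrictions Q n T"
  then obtain i j where ij: "i \<in> {1..n}" "a = restrict (T i) Q" "j \<in> {1..n}" "b = restrict (T j) Q"
    unfolding restrictions_def by blast
  have "compose Q a b = compose Q b a"
    using ij T_closed T_comm Q_subset by (auto simp: compose_def fun_eq_iff)
  moreover have "a \<in> Bij Q" "b \<in> Bij Q" using ab sub by (auto simp: BijGroup_def)
  ultimately show "a \<otimes>\<^bsub>BijGroup Q\<^esub> b = b \<otimes>\<^bsub>BijGroup Q\<^esub> a" by (simp add: BijGroup_def)
qed

text \<open>Follow the construction of \<open>S\<close> from the generators, replacing each
  \<open>T i\<close> by its restriction and inverses by inverses in \<open>H Q\<close>. Agreement at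
  a single point suffices for the transitivity of \<open>H Q\<close> on \<open>Q\<close>.\<close>

lemma G_apply_in_H:
  assumes "S \<in> carrier G" "x \<in> Q"
  shows "\<exists>h\<in>carrier (H Q). S x = h x"
proof -
  interpret H: comm_group "H Q" by (rule comm_group_H)
  have "T ` {1..n} \<subseteq> Bij A" using T_bij by blast
  then have "S \<in> generate (BijGroup A) (T ` {1..n})"
    using assms(1)
    by (simp add: transformation_group_def carrier_subgroup_generated BijGroup_def Int_absorb1)
  then show ?thesis using assms(2)
  proof (induction arbitrary: x rule: generate.induct)
    case one
    then show ?case
      using Q_subset one_transformation_group_apply[of x Q]
      by (intro bexI[OF _ H.one_closed]) (auto simp: BijGroup_def)
  next
    case (incl h)
    then obtain i where i: "i \<in> {1..n}" "h = T i" by blast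
    then have "restrict (T i) Q \<in> carrier (H Q)"
      using restrictions_carrier by (auto simp: restrictions_def)
    with i incl show ?case by (intro bexI[of _ "restrict (T i) Q"]) auto
  next
    case (inv h)
    then obtain i where i: "i \<in> {1..n}" "h = T i" by blast
    let ?r = "restrict (T i) Q"
    have r: "?r \<in> carrier (H Q)"
      using i restrictions_carrier by (auto simp: restrictions_def)
    let ?y = "(inv\<^bsub>H Q\<^esub> ?r) x"
    have y: "?y \<in> Q" using transformation_group_apply_mem[OF H.inv_closed[OF r]] inv by blast
    have "T i ?y = x" using transformation_group_inv_apply[OF r, of x] y inv by simp
    \<comment> \<open>Injectivity makes \<open>?y\<close> the only preimage of \<open>x\<close>
      under \<open>T i\<close>, so the inverse taken on all of \<open>A\<close> has the same value
      at \<open>x\<close>.\<close>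
    moreover have "inj_on (T i) A" using T_bij[OF i(1)] by (simp add: Bij_def bij_betw_def)
    moreover have "?y \<in> A" "x \<in> A" using y inv Q_subset by auto
    ultimately have "(inv\<^bsub>BijGroup A\<^esub> T i) x = ?y"
      using T_bij[OF i(1)] inv_into_f_f[of "T i" A ?y] by (simp add: inv_BijGroup)
    then show ?case using i r H.inv_closed[OF r] by auto
  next
    case (eng h1 h2)
    obtain k2 where k2: "k2 \<in> carrier (H Q)" "h2 x = k2 x" using eng by blast
    have "k2 x \<in> Q" using transformation_group_apply_mem[OF k2(1) eng(5)] .
    then obtain k1 where k1: "k1 \<in> carrier (H Q)" "h1 (k2 x) = k1 (k2 x)" using eng by blast
    have "T ` {1..n} \<subseteq> carrier (BijGroup A)" using T_bij by (auto simp: BijGroup_def)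
    note group.generate_in_carrier[OF group_BijGroup this]
    from this[OF eng(1)] this[OF eng(2)] have "h1 \<in> Bij A" "h2 \<in> Bij A"
      by (simp_all add: BijGroup_def)
    moreover have "x \<in> A" using eng(5) Q_subset by blast
    ultimately have "(h1 \<otimes>\<^bsub>BijGroup A\<^esub> h2) x = h1 (h2 x)"
      by (simp add: BijGroup_def compose_def)
    also have "\<dots> = (k1 \<otimes>\<^bsub>H Q\<^esub> k2) x"
      using k1 k2 by (simp add: mult_transformation_group_apply[OF k1(1) k2(1) eng(5)])
    finally show ?case using H.m_closed[OF k1(1) k2(1)] by blast
  qed
qed

text \<open>A transitive Abelian action: if \<open>h\<close> and \<open>k\<close> agree at
  \<open>x\<close>, they agree at every \<open>m x\<close>, since \<open>m\<close> commutes with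
  both. Both are \<open>undefined\<close> off \<open>Q\<close>, so they are equal.\<close>

lemma bij_betw_H_Q:
  assumes x: "x \<in> Q"
  shows "bij_betw (\<lambda>h. h x) (carrier (H Q)) Q"
proof -
  interpret H: comm_group "H Q" by (rule comm_group_H)
  have surj: "\<exists>h\<in>carrier (H Q). y = h x" if "y \<in> Q" for y
    using orbit_eq[OF Q x] that G_apply_in_H[OF _ x] by (auto simp: orbit_def)
  have "h = k" if hk: "h \<in> carrier (H Q)" "k \<in> carrier (H Q)" "h x = k x" for h k
  proof (rule extensionalityI)
    show "h \<in> extensional Q" "k \<in> extensional Q"
      using hk carrier_transformation_group by (blast intro: Bij_imp_extensional)+
    fix y assume "y \<in> Q"
    then obtain m where m: "m \<in> carrier (H Q)" "y = m x" using surj by blast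
    have "h' y = m (h' x)" if "h' \<in> carrier (H Q)" for h'
    proof -
      have "h' y = (h' \<otimes>\<^bsub>H Q\<^esub> m) x" using that m x by (simp add: mult_transformation_group_apply)
      also have "\<dots> = (m \<otimes>\<^bsub>H Q\<^esub> h') x" using that m by (simp add: H.m_comm)
      also have "\<dots> = m (h' x)" using that m x by (simp add: mult_transformation_group_apply)
      finally show ?thesis .
    qed
    from this[OF hk(1)] this[OF hk(2)] show "h y = k y" by (simp only: hk(3))
  qed
  moreover have "(\<lambda>h. h x) ` carrier (H Q) = Q"
    using surj transformation_group_apply_mem[OF _ x] by (fast intro: image_eqI)
  ultimately show ?thesis by (simp add: bij_betw_def inj_on_def)
qed

text \<open>Evaluation at \<open>x\<close> turns multiplication by \<open>s\<close> into the action
  of \<open>s\<close>. All points met lie in \<open>Q\<close>, so the restriction of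
  \<open>f\<close> is harmless.\<close>

lemma diff_ops_transfer:
  assumes x: "x \<in> Q" and Ss: "set Ss \<subseteq> carrier (H Q)" and h: "h \<in> carrier (H Q)"
  shows "diff_ops Ss (restrict f Q) (h x) = diff_ops (map (mult (H Q)) Ss) (\<lambda>h. f (h x)) h"
proof -
  interpret H: comm_group "H Q" by (rule comm_group_H)
  show ?thesis
    using Ss h
  proof (induction Ss arbitrary: h)
    case Nil
    then show ?case using transformation_group_apply_mem[OF _ x] by simp
  next
    case (Cons s Ss)
    then have "s (h x) = (s \<otimes>\<^bsub>H Q\<^esub> h) x"
      using x by (simp add: mult_transformation_group_apply)
    with Cons show ?case by (simp add: diff_op_def)
  qed
qed

lemma annihilated_on_orbit_iff:
  assumes x: "x \<in> Q"
  shows "comm_group.annihilated (H Q) (restrictions Q n T) (\<lambda>h. f (h x)) \<longleftrightarrow>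
    (\<forall>Bs. distinct Bs \<and> partition_on (restrictions Q n T) (set Bs) \<longrightarrow>
      (\<forall>Ss. length Ss = length Bs \<and> (\<forall>j < length Bs. Ss ! j \<in> cyclic_inter (H Q) (Bs ! j)) \<longrightarrow>
        (\<forall>y\<in>Q. diff_ops Ss (restrict f Q) y = 0)))" (is "_ = ?R")
proof -
  interpret H: comm_group "H Q" by (rule comm_group_H)
  have "(\<forall>h\<in>carrier (H Q). diff_ops (map (mult (H Q)) Ss) (\<lambda>h. f (h x)) h = 0) \<longleftrightarrow>
      (\<forall>y\<in>Q. diff_ops Ss (restrict f Q) y = 0)"
    if "partition_on (restrictions Q n T) (set Bs)"
      "list_all2 (\<lambda>S C. S \<in> cyclic_inter (H Q) C) Ss Bs" for Bs Ss
  proof -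
    have "set Ss \<subseteq> carrier (H Q)"
      by (rule H.cyclic_inter_list_carrier[OF restrictions_carrier that])
    then have "(\<forall>h\<in>carrier (H Q). diff_ops (map (mult (H Q)) Ss) (\<lambda>h. f (h x)) h = 0) \<longleftrightarrow>
        (\<forall>y\<in>(\<lambda>h. h x) ` carrier (H Q). diff_ops Ss (restrict f Q) y = 0)"
      by (simp add: diff_ops_transfer[OF x])
    then show ?thesis
      unfolding bij_betw_imp_surj_on[OF bij_betw_H_Q[OF x]] .
  qed
  then have "H.annihilated (restrictions Q n T) (\<lambda>h. f (h x)) \<longleftrightarrow>
    (\<forall>Bs Ss. distinct Bs \<and> partition_on (restrictions Q n T) (set Bs) \<and>
      list_all2 (\<lambda>S C. S \<in> cyclic_inter (H Q) C) Ss Bs \<longrightarrow>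
      (\<forall>y\<in>Q. diff_ops Ss (restrict f Q) y = 0))"
    unfolding H.annihilated_def by (intro all_cong1 imp_cong refl, elim conjE)
  moreover have "list_all2 (\<lambda>S C. S \<in> cyclic_inter (H Q) C) Ss Bs \<longleftrightarrow>
      length Ss = length Bs \<and> (\<forall>j < length Bs. Ss ! j \<in> cyclic_inter (H Q) (Bs ! j))" for Ss Bs
    by (auto simp: list_all2_conv_all_nth)
  ultimately show ?thesis by (simp only:) blast
qed

lemma decomposes_on_orbit_iff:
  fixes f :: "'a \<Rightarrow> real"
  assumes x: "x \<in> Q"
  shows "comm_group.decomposes (H Q) (restrictions Q n T) (\<lambda>h. f (h x)) \<longleftrightarrow>
    (\<exists>g. (\<forall>y\<in>Q. f y = (\<Sum>j=1..n. g j y)) \<and> (\<forall>j\<in>{1..n}. \<forall>y\<in>Q. g j (T j y) = g j y))"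
    (is "?L = ?R")
proof -
  interpret H: comm_group "H Q" by (rule comm_group_H)
  let ?r = "\<lambda>i. restrict (T i) Q"
  note bij = bij_betw_H_Q[OF x]
  have r: "?r j \<in> carrier (H Q)" "?r j \<in> restrictions Q n T" if "j \<in> {1..n}" for j
    using that restrictions_carrier by (auto simp: restrictions_def)
  have r_mult: "(?r j \<otimes>\<^bsub>H Q\<^esub> h) x = T j (h x)" if "j \<in> {1..n}" "h \<in> carrier (H Q)" for j h
    using that r x transformation_group_apply_mem[OF that(2) x]
    by (simp add: mult_transformation_group_apply)
  show ?thesis
  proof
    assume ?R
    then obtain g where g: "\<And>y. y \<in> Q \<Longrightarrow> f y = (\<Sum>j=1..n. g j y)"
      "\<And>j y. j \<in> {1..n} \<Longrightarrow> y \<in> Q \<Longrightarrow> g j (T j y) = g j y" by blast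
    \<comment> \<open>Collects the summands of all indices with the same restriction
      \<open>b\<close>; each of them is \<open>b\<close>-periodic.\<close>
    define p where "p b h = (\<Sum>j | j \<in> {1..n} \<and> ?r j = b. g j (h x))" for b h
    have "f (h x) = (\<Sum>b\<in>restrictions Q n T. p b h)" if "h \<in> carrier (H Q)" for h
    proof -
      have "f (h x) = (\<Sum>j=1..n. g j (h x))"
        using g(1) transformation_group_apply_mem[OF that x] .
      also have "\<dots> = (\<Sum>b\<in>?r ` {1..n}. p b h)"
        unfolding p_def by (rule sum.image_gen) simp
      finally show ?thesis by (simp add: restrictions_def)
    qed
    moreover have "p b (b \<otimes>\<^bsub>H Q\<^esub> h) = p b h" if "h \<in> carrier (H Q)" for b h
      unfolding p_def
    proof (rule sum.cong[OF refl])
      fix j assume "j \<in> {j. j \<in> {1..n} \<and> ?r j = b}"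
      then have j: "j \<in> {1..n}" "b = ?r j" by auto
      show "g j ((b \<otimes>\<^bsub>H Q\<^esub> h) x) = g j (h x)"
        unfolding j(2) r_mult[OF j(1) that]
        by (rule g(2)[OF j(1) transformation_group_apply_mem[OF that x]])
    qed
    ultimately show ?L unfolding H.decomposes_def by blast
  next
    assume ?L
    then obtain p where p: "\<And>h. h \<in> carrier (H Q) \<Longrightarrow> f (h x) = (\<Sum>b\<in>restrictions Q n T. p b h)"
      "\<And>b h. b \<in> restrictions Q n T \<Longrightarrow> h \<in> carrier (H Q) \<Longrightarrow> p b (b \<otimes>\<^bsub>H Q\<^esub> h) = p b h"
      unfolding H.decomposes_def by blast
    \<comment> \<open>Coinciding restrictions count once in \<open>restrictions Q n T\<close>: one index is kept for each.\<close>
    obtain I where I: "I \<subseteq> {1..n}" "inj_on ?r I" "?r ` {1..n} = ?r ` I"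
      using subset_image_inj[of "?r ` {1..n}" ?r "{1..n}"] by auto
    define e where "e = inv_into (carrier (H Q)) (\<lambda>h. h x)"
    have e: "e y \<in> carrier (H Q)" "e y x = y" if "y \<in> Q" for y
      using bij that f_inv_into_f[of y "\<lambda>h. h x" "carrier (H Q)"]
      by (auto simp: e_def bij_betw_def inv_into_into)
    have e_apply: "e (h x) = h" if "h \<in> carrier (H Q)" for h
      using bij that inv_into_f_f[of "\<lambda>h. h x" "carrier (H Q)" h] by (simp add: e_def bij_betw_def)
    \<comment> \<open>Indices outside \<open>I\<close> receive the zero function, which is periodic
      under any transformation.\<close>
    define g where "g j y = (if j \<in> I then p (?r j) (e y) else 0)" for j y
    have "f y = (\<Sum>j=1..n. g j y)" if "y \<in> Q" for y
    proof -
      have "f y = (\<Sum>b\<in>?r ` I. p b (e y))"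
        using p(1)[OF e(1)[OF that]] e(2)[OF that] I(3) by (simp add: restrictions_def)
      also have "\<dots> = (\<Sum>j\<in>I. p (?r j) (e y))"
        by (simp add: sum.reindex[OF I(2)])
      also have "\<dots> = (\<Sum>j=1..n. g j y)"
        using I(1) by (simp add: g_def sum.If_cases Int_absorb1)
      finally show ?thesis .
    qed
    moreover have "g j (T j y) = g j y" if "j \<in> {1..n}" "y \<in> Q" for j y
    proof -
      have "e (T j y) = ?r j \<otimes>\<^bsub>H Q\<^esub> e y"
        using e_apply[of "?r j \<otimes>\<^bsub>H Q\<^esub> e y"] r_mult[OF that(1) e(1)[OF that(2)]]
          r(1)[OF that(1)] e[OF that(2)] by simp
      then show ?thesis using p(2)[OF r(2)[OF that(1)] e(1)[OF that(2)]] by (simp add: g_def)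
    qed
    ultimately show ?R by blast
  qed
qed

end

section \<open>Gluing the orbits and the final equivalence\<close>

lemma has_periodic_decomposition_iff_on_orbits:
  fixes f :: "'a \<Rightarrow> real"
  shows "has_periodic_decomposition A n T f \<longleftrightarrow>
    (\<forall>Q\<in>orbits G A (\<lambda>S. S).
      \<exists>g. (\<forall>y\<in>Q. f y = (\<Sum>j=1..n. g j y)) \<and> (\<forall>j\<in>{1..n}. \<forall>y\<in>Q. g j (T j y) = g j y))"
  (is "?L = ?R")
proof
  assume ?L
  then obtain g where "\<forall>x\<in>A. f x = (\<Sum>j=1..n. g j x)" "\<forall>j\<in>{1..n}. \<forall>x\<in>A. g j (T j x) = g j x"
    unfolding has_periodic_decomposition_def periodic_on_def diff_op_def by auto
  then show ?R using Q_subset by (intro ballI exI[of _ g]) blast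
next
  assume ?R
  then obtain g where g: "\<And>Q y. Q \<in> orbits G A (\<lambda>S. S) \<Longrightarrow> y \<in> Q \<Longrightarrow> f y = (\<Sum>j=1..n. g Q j y)"
    "\<And>Q j y. Q \<in> orbits G A (\<lambda>S. S) \<Longrightarrow> j \<in> {1..n} \<Longrightarrow> y \<in> Q \<Longrightarrow> g Q j (T j y) = g Q j y"
    by metis
  interpret group G by (rule group_transformation_group)
  let ?orb = "orbit G (\<lambda>S. S)"
  have orb: "?orb y \<in> orbits G A (\<lambda>S. S)" "y \<in> ?orb y" if "y \<in> A" for y
  proof -
    show "?orb y \<in> orbits G A (\<lambda>S. S)" using that by (auto simp: orbits_def)
    show "y \<in> ?orb y"
      using one_closed one_transformation_group_apply[OF that] unfolding orbit_def
      by (metis (mono_tags, lifting) mem_Collect_eq)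
  qed
  \<comment> \<open>The decompositions on different orbits are chosen independently. Periodicity
    survives the gluing because \<open>T j y\<close> lies in the orbit of \<open>y\<close>, so both
    points use the same choice.\<close>
  define g' where "g' j y = g (?orb y) j y" for j y
  have "g' j (T j y) = g' j y" if "j \<in> {1..n}" "y \<in> A" for j y
  proof -
    note o = orb[OF that(2)]
    have "?orb (T j y) = ?orb y"
      using orbit_eq[OF o(1) T_closed[OF o(1) that(1) o(2)]] by simp
    then show ?thesis using g(2)[OF o(1) that(1) o(2)] by (simp add: g'_def)
  qed
  moreover have "f y = (\<Sum>j=1..n. g' j y)" if "y \<in> A" for y
    using g(1)[OF orb[OF that]] by (simp add: g'_def)
  ultimately show ?L
    unfolding has_periodic_decomposition_def periodic_on_def diff_op_def
    by (intro exI[of _ g']) auto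
qed

theorem has_periodic_decomposition_iff:
  fixes f :: "'a \<Rightarrow> real"
  shows "has_periodic_decomposition A n T f \<longleftrightarrow>
    (\<forall>Q\<in>orbits G A (\<lambda>S. S).
      \<forall>Bs. distinct Bs \<and> partition_on (restrictions Q n T) (set Bs) \<longrightarrow>
        (\<forall>Ss. length Ss = length Bs \<and> (\<forall>j < length Bs. Ss ! j \<in> cyclic_inter (H Q) (Bs ! j)) \<longrightarrow>
          (\<forall>x\<in>Q. diff_ops Ss (restrict f Q) x = 0)))"
  unfolding has_periodic_decomposition_iff_on_orbits
proof (rule ball_cong[OF refl])
  fix Q assume Q: "Q \<in> orbits G A (\<lambda>S. S)"
  obtain x where x: "x \<in> Q" using Q_nonempty[OF Q] by blast
  have "finite (restrictions Q n T)" by (simp add: restrictions_def)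
  note eq = comm_group.decomposes_iff_annihilated[OF comm_group_H[OF Q] this restrictions_carrier[OF Q]]
  show "(\<exists>g. (\<forall>y\<in>Q. f y = (\<Sum>j=1..n. g j y)) \<and> (\<forall>j\<in>{1..n}. \<forall>y\<in>Q. g j (T j y) = g j y)) \<longleftrightarrow>
    (\<forall>Bs. distinct Bs \<and> partition_on (restrictions Q n T) (set Bs) \<longrightarrow>
        (\<forall>Ss. length Ss = length Bs \<and> (\<forall>j < length Bs. Ss ! j \<in> cyclic_inter (H Q) (Bs ! j)) \<longrightarrow>
          (\<forall>x\<in>Q. diff_ops Ss (restrict f Q) x = 0)))"
    unfolding decomposes_on_orbit_iff[OF Q x, symmetric] annihilated_on_orbit_iff[OF Q x, symmetric]
    by (rule eq)
qed

end

theorem theorem2p3: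
  fixes A :: "'a set" and n :: nat and T :: "nat \<Rightarrow> 'a \<Rightarrow> 'a" and f :: "'a \<Rightarrow> real"
  assumes T_bij: "\<And>i. i \<in> {1..n} \<Longrightarrow> T i \<in> Bij A"
    and T_comm: "\<And>i j x. \<lbrakk>i \<in> {1..n}; j \<in> {1..n}; x \<in> A\<rbrakk> \<Longrightarrow> T i (T j x) = T j (T i x)"
  shows "has_periodic_decomposition A n T f \<longleftrightarrow>
    (\<forall>Q \<in> orbits (transformation_group A (T ` {1..n})) A (\<lambda>S. S).
      \<forall>Bs :: ('a \<Rightarrow> 'a) set list.
        distinct Bs \<and> partition_on (restrictions Q n T) (set Bs) \<longrightarrow>
        (\<forall>Ss :: ('a \<Rightarrow> 'a) list.
          length Ss = length Bs \<and>
          (\<forall>j < length Bs.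
             Ss ! j \<in> cyclic_inter (transformation_group Q (restrictions Q n T)) (Bs ! j)) \<longrightarrow>
          (\<forall>x\<in>Q. diff_ops Ss (restrict f Q) x = 0)))"
proof -
  interpret commuting_transformations A n T
    by unfold_locales (rule T_bij, assumption, rule T_comm)
  show ?thesis by (rule has_periodic_decomposition_iff)
qed

end
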